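(* Let the coarse dynamical systems $[(M,\mathcal{E}_M),\phi,(G,\mathcal{E}_G,\ast)]$ and $[(\tilde{M},\mathcal{E}_{\tilde{M}}),\tilde{\phi},(\tilde{G},\mathcal{E}_{\tilde{G}},\tilde{\ast})]$ be $(f,h)$-coarse conjugate. Then the induced set-value coarse dynamical systems $[(P(M),\exp\mathcal{E}_M),\exp\phi,(G,\mathcal{E}_G,\ast)]$ and $[(P(\tilde{M}),\exp\mathcal{E}_{\tilde{M}}),\exp\tilde{\phi},(\tilde{G},\mathcal{E}_{\tilde{G}},\tilde{\ast})]$ are $(\exp f,h)$-coarse conjugate.
   Context: Coarse space: a pair $(M,\mathcal{E}_M)$ where $M$ is a set and $\mathcal{E}_M\subseteq P(M\times M)$ (a coarse structure, whose elements are called entourages) contains the diagonal $\{(m,m): m\in M\}$, is closed under taking subsets and under finite unions, and for all $E,F\in\mathcal{E}_M$ contains $E^{-1}=\{(m_2,m_1):(m_1,m_2)\in E\}$ and $E\circ F=\{(m_1,m_2)\in M\times M:\exists\, m_3\in M,\ (m_1,m_3)\in E,\ (m_3,m_2)\in F\}$. For $E\in\mathcal{E}_M$, $m\in M$ and $N\subseteq M$, put $E[m]=\{m'\in M:(m,m')\in E\}$ and $E[N]=\bigcup_{n\in N}E[n]$. Asymorphism: a map $f:(M,\mathcal{E}_M)\to(N,\mathcal{E}_N)$ between coarse spaces is bornologous if $(f\times f)(E)\in\mathcal{E}_N$ for every $E\in\mathcal{E}_M$, where $(f\times f)(m_1,m_2)=(f(m_1),f(m_2))$. An asymorphism is a bijection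 $f$ such that both $f$ and $f^{-1}$ are bornologous. Coarse group: a triple $(G,\mathcal{E}_G,\ast)$ where $(G,\ast)$ is a group and $\mathcal{E}_G$ is a coarse structure on $G$ such that for every $E\in\mathcal{E}_G$ the set $\{(g\ast e_1,g\ast e_2): g\in G,\ (e_1,e_2)\in E\}$ belongs to $\mathcal{E}_G$. Coarse dynamical system (with coarse time): a triple $[(M,\mathcal{E}_M),\phi,(G,\mathcal{E}_G,\ast)]$ where $(M,\mathcal{E}_M)$ is a non-empty coarse space, $(G,\mathcal{E}_G,\ast)$ is a coarse group, and $\phi=(\phi^g)_{g\in G}$ is a family of asymorphisms $\phi^g:M\to M$ such that $\phi^{g_1}(\phi^{g_2}(m))=\phi^{g_1\ast g_2}(m)$ for all $g_1,g_2\in G$, $m\in M$, and $\phi^e=\mathrm{Id}_M$, where $e$ is the identity element of $G$. Coarse conjugacy: two coarse dynamical systems $[(M,\mathcal{E}_M),\phi,(G,\mathcal{E}_G,\ast)]$ and $[(\tilde{M},\mathcal{E}_{\tilde{M}}),\tilde{\phi},(\tilde{G},\mathcal{E}_{\tilde{G}},\tilde{\ast})]$ are $(f,h)$-coarse conjugate if $f:(M,\mathcal{E}_M)\to(\tilde{M},\mathcal{E}_{\tilde{M}})$ and $h:(G,\mathcal{E}_G)\to(\tilde{G},\mathcal{E}_{\tilde{G}})$ are asymorphisms such that $h(g_1\ast g_2)=h(g_1)\,\tilde{\ast}\,h(g_2)$ for all $g_1,g_2\in G$, and $f\circ\phi^g=\tilde{\phi}^{h(g)}\circ f$ for all $g\in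 G$. Coarse hyperspace: for a coarse space $(M,\mathcal{E}_M)$ and $E\in\mathcal{E}_M$, let $E^*=\{(K,L)\in P(M)\times P(M): K\subseteq E[L],\ L\subseteq E[K]\}$, where $P(M)$ is the power set of $M$. The coarse structure $\exp\mathcal{E}_M$ on $P(M)$ consists of all subsets of the sets $E^*$, $E\in\mathcal{E}_M$. For a map $f:M\to\tilde{M}$, $\exp f:P(M)\to P(\tilde{M})$ is the direct image map $K\mapsto f(K)$. It is known that $\exp\mathcal{E}_M$ is a coarse structure and that $f$ is an asymorphism if and only if $\exp f$ is an asymorphism. Set-value coarse dynamical system induced by $[(M,\mathcal{E}_M),\phi,(G,\mathcal{E}_G,\ast)]$: the triple $[(P(M),\exp\mathcal{E}_M),\exp\phi,(G,\mathcal{E}_G,\ast)]$, where $\exp\phi=(\exp\phi^g)_{g\in G}$; it satisfies $\exp\phi^{g_1}(\exp\phi^{g_2}(N))=\exp\phi^{g_1\ast g_2}(N)$ for all $g_1,g_2\in G$, $N\in P(M)$, and $\exp\phi^e=\mathrm{Id}_{P(M)}$. The systems $[(P(M),\exp\mathcal{E}_M),\exp\phi,(G,\mathcal{E}_G,\ast)]$ and $[(P(\tilde{M}),\exp\mathcal{E}_{\tilde{M}}),\exp\tilde{\phi},(\tilde{G},\mathcal{E}_{\tilde{G}},\tilde{\ast})]$ being $(\exp f,h)$-coarse conjugate means that $\exp f:(P(M),\exp\mathcal{E}_M)\to(P(\tilde{M}),\exp\mathcal{E}_{\tilde{M}})$ and $h:(G,\mathcal{E}_G)\to(\tilde{G},\mathcal{E}_{\tilde{G}})$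 are asymorphisms such that $h(g_1\ast g_2)=h(g_1)\,\tilde{\ast}\,h(g_2)$ for all $g_1,g_2\in G$, and $\exp f\circ\exp\phi^g=\exp\tilde{\phi}^{h(g)}\circ\exp f$ for all $g\in G$. *)

theory Defs
  imports "HOL-Algebra.Group"
begin

text \<open>
  Spaces are carrier sets \<open>M\<close> inside a type, and maps between them are total HOL functions of
  which only the restriction to the carrier matters. The composition of entourages
  is \<^const>\<open>relcomp\<close>, and $E[N]$ is the relational image \<open>E `` N\<close>.
\<close>

locale coarse_space =
  fixes M :: "'m set" and \<E> :: "('m \<times> 'm) set set"
  assumes entourage_subset: "E \<in> \<E> \<Longrightarrow> E \<subseteq> M \<times> M"
    and diagonal: "Id_on M \<in> \<E>"
    and subset_closed: "\<lbrakk>E \<in> \<E>; F \<subseteq> E\<rbrakk> \<Longrightarrow> F \<in> \<E>"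
    and union_closed: "\<lbrakk>E \<in> \<E>; F \<in> \<E>\<rbrakk> \<Longrightarrow> E \<union> F \<in> \<E>"
    and converse_closed: "E \<in> \<E> \<Longrightarrow> E\<inverse> \<in> \<E>"
    and relcomp_closed: "\<lbrakk>E \<in> \<E>; F \<in> \<E>\<rbrakk> \<Longrightarrow> E O F \<in> \<E>"

definition bornologous ::
    "'m set \<Rightarrow> ('m \<times> 'm) set set \<Rightarrow> 'n set \<Rightarrow> ('n \<times> 'n) set set \<Rightarrow> ('m \<Rightarrow> 'n) \<Rightarrow> bool" where
  "bornologous M \<E> N \<F> f \<longleftrightarrow> f \<in> M \<rightarrow> N \<and> (\<forall>E\<in>\<E>. map_prod f f ` E \<in> \<F>)"

definition asymorphism ::
    "'m set \<Rightarrow> ('m \<times> 'm) set set \<Rightarrow> 'n set \<Rightarrow> ('n \<times> 'n) set set \<Rightarrow> ('m \<Rightarrow> 'n) \<Rightarrow> bool" where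
  "asymorphism M \<E> N \<F> f \<longleftrightarrow>
     bij_betw f M N \<and> bornologous M \<E> N \<F> f \<and> bornologous N \<F> M \<E> (inv_into M f)"

locale coarse_group = group G + coarse_space "carrier G" \<E>
  for G (structure) and \<E> +
  assumes translates: "E \<in> \<E> \<Longrightarrow> {(g \<otimes> e1, g \<otimes> e2) | g e1 e2. g \<in> carrier G \<and> (e1, e2) \<in> E} \<in> \<E>"

locale coarse_dynamical_system =
  phase: coarse_space M \<E> + time: coarse_group G \<G>
  for M :: "'m set" and \<E> and \<phi> :: "'g \<Rightarrow> 'm \<Rightarrow> 'm" and G (structure) and \<G> +
  assumes nonempty: "M \<noteq> {}"
    and asymorphism: "g \<in> carrier G \<Longrightarrow> asymorphism M \<E> M \<E> (\<phi> g)"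
    and action_mult:
      "\<lbrakk>g1 \<in> carrier G; g2 \<in> carrier G; m \<in> M\<rbrakk> \<Longrightarrow> \<phi> g1 (\<phi> g2 m) = \<phi> (g1 \<otimes> g2) m"
    and action_one: "m \<in> M \<Longrightarrow> \<phi> \<one> m = m"

definition coarse_conjugate where
  "coarse_conjugate M \<E> \<phi> G \<G> M' \<E>' \<phi>' G' \<G>' f h \<longleftrightarrow>
     coarse_dynamical_system M \<E> \<phi> G \<G> \<and>
     coarse_dynamical_system M' \<E>' \<phi>' G' \<G>' \<and>
     asymorphism M \<E> M' \<E>' f \<and>
     asymorphism (carrier G) \<G> (carrier G') \<G>' h \<and>
     h \<in> hom G G' \<and>
     (\<forall>g\<in>carrier G. \<forall>m\<in>M. f (\<phi> g m) = \<phi>' (h g) (f m))"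

definition hyper_entourage :: "'m set \<Rightarrow> ('m \<times> 'm) set \<Rightarrow> ('m set \<times> 'm set) set" where
  "hyper_entourage M E = {(K, L) \<in> Pow M \<times> Pow M. K \<subseteq> E `` L \<and> L \<subseteq> E `` K}"

definition hyper_structure ::
    "'m set \<Rightarrow> ('m \<times> 'm) set set \<Rightarrow> ('m set \<times> 'm set) set set" where
  "hyper_structure M \<E> = {A. \<exists>E\<in>\<E>. A \<subseteq> hyper_entourage M E}"

definition hyper_action :: "('g \<Rightarrow> 'm \<Rightarrow> 'm) \<Rightarrow> 'g \<Rightarrow> 'm set \<Rightarrow> 'm set" where
  "hyper_action \<phi> = (\<lambda>g. image (\<phi> g))"

end

theory Submission
  imports Defs
begin

text \<open>
  Passing to direct images is functorial, and it preserves everything that enters a coarse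
  conjugacy. The equations of the action and the intertwining relation
  \<open>f \<circ> \<phi> g = \<phi>' (h g) \<circ> f\<close> hold pointwise, so they hold for images of subsets; the time group
  and \<open>h\<close> do not change. What remains is coarse geometry: \<open>hyper_structure M \<E>\<close> is a coarse
  structure on \<open>Pow M\<close> (\<open>coarse_space_hyper\<close>), and \<open>image f\<close> is an asymorphism if \<open>f\<close> is
  (\<open>asymorphism_image\<close>). The second fact rests on the inclusion
  \<open>f ` (E `` K) \<subseteq> (map_prod f f ` E) `` (f ` K)\<close>, by which the pushforward of an entourage
  controls the images of all pairs of sets controlled by the entourage itself. It is applied
  both to \<open>f\<close> and to its inverse on the carrier, whose direct image map inverts \<open>image f\<close> on
  subsets of the target.
\<close>

lemma hyper_entourage_subset: "hyper_entourage M E \<subseteq> Pow M \<times> Pow M"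
  by (auto simp: hyper_entourage_def)

lemma hyper_structure_subset:
  assumes "A \<in> hyper_structure M \<E>"
  shows "A \<subseteq> Pow M \<times> Pow M"
proof -
  obtain E where "A \<subseteq> hyper_entourage M E"
    using assms by (auto simp: hyper_structure_def)
  then show ?thesis using hyper_entourage_subset by (rule subset_trans)
qed

lemma hyper_entourage_mono: "E \<subseteq> F \<Longrightarrow> hyper_entourage M E \<subseteq> hyper_entourage M F"
  using Image_mono[of E F] by (fastforce simp: hyper_entourage_def)

lemma converse_hyper_entourage: "(hyper_entourage M E)\<inverse> = hyper_entourage M E"
  by (auto simp: hyper_entourage_def)

text \<open>
  Both orders of composition occur because the two inclusions that define the relation are
  composed in opposite directions: from \<open>K \<subseteq> E `` L\<close> and \<open>L \<subseteq> F `` N\<close> follows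
  \<open>K \<subseteq> (F O E) `` N\<close>, whereas \<open>N \<subseteq> F `` L\<close> and \<open>L \<subseteq> E `` K\<close> give \<open>N \<subseteq> (E O F) `` K\<close>.
\<close>

lemma hyper_entourage_relcomp:
  "hyper_entourage M E O hyper_entourage M F \<subseteq> hyper_entourage M (E O F \<union> F O E)"
proof clarify
  fix K L N
  assume "(K, L) \<in> hyper_entourage M E" "(L, N) \<in> hyper_entourage M F"
  then have sub: "K \<subseteq> M" "N \<subseteq> M"
    and KL: "K \<subseteq> E `` L" "L \<subseteq> E `` K" and LN: "L \<subseteq> F `` N" "N \<subseteq> F `` L"
    by (auto simp: hyper_entourage_def)
  have "K \<subseteq> (F O E) `` N"
    using KL(1) Image_mono[OF subset_refl LN(1), of E] by (simp add: relcomp_Image)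
  moreover have "N \<subseteq> (E O F) `` K"
    using LN(2) Image_mono[OF subset_refl KL(2), of F] by (simp add: relcomp_Image)
  ultimately show "(K, N) \<in> hyper_entourage M (E O F \<union> F O E)"
    using sub by (auto simp: hyper_entourage_def Un_Image)
qed

lemma coarse_space_hyper:
  assumes "coarse_space M \<E>"
  shows "coarse_space (Pow M) (hyper_structure M \<E>)"
proof -
  interpret coarse_space M \<E> by (fact assms)
  show ?thesis
  proof
    show "A \<subseteq> Pow M \<times> Pow M" if "A \<in> hyper_structure M \<E>" for A
      using that by (rule hyper_structure_subset)
  next
    have "Id_on (Pow M) \<subseteq> hyper_entourage M (Id_on M)"
      by (auto simp: hyper_entourage_def)
    then show "Id_on (Pow M) \<in> hyper_structure M \<E>"
      using diagonal by (auto simp: hyper_structure_def)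
  next
    fix A B assume "A \<in> hyper_structure M \<E>" "B \<subseteq> A"
    then show "B \<in> hyper_structure M \<E>"
      by (auto simp: hyper_structure_def)
  next
    fix A B assume "A \<in> hyper_structure M \<E>" "B \<in> hyper_structure M \<E>"
    then obtain E F where EF: "E \<in> \<E>" "F \<in> \<E>"
      and A: "A \<subseteq> hyper_entourage M E" and B: "B \<subseteq> hyper_entourage M F"
      by (auto simp: hyper_structure_def)
    have "A \<union> B \<subseteq> hyper_entourage M (E \<union> F)"
      using A B hyper_entourage_mono[of E "E \<union> F" M] hyper_entourage_mono[of F "E \<union> F" M]
      by blast
    then show "A \<union> B \<in> hyper_structure M \<E>"
      using union_closed[OF EF] by (auto simp: hyper_structure_def)
    have "A O B \<subseteq> hyper_entourage M (E O F \<union> F O E)"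
      using relcomp_mono[OF A B] hyper_entourage_relcomp by (rule subset_trans)
    then show "A O B \<in> hyper_structure M \<E>"
      using union_closed[OF relcomp_closed[OF EF] relcomp_closed[OF EF(2,1)]]
      by (auto simp: hyper_structure_def)
  next
    fix A assume "A \<in> hyper_structure M \<E>"
    then obtain E where "E \<in> \<E>" "A \<subseteq> hyper_entourage M E"
      by (auto simp: hyper_structure_def)
    moreover from this have "A\<inverse> \<subseteq> hyper_entourage M E"
      using converse_hyper_entourage[of M E] by blast
    ultimately show "A\<inverse> \<in> hyper_structure M \<E>"
      by (auto simp: hyper_structure_def)
  qed
qed

lemma image_Image_subset: "f ` (E `` K) \<subseteq> (map_prod f f ` E) `` (f ` K)"
proof clarify
  fix x y assume "(x, y) \<in> E" "x \<in> K"
  then have "(f x, f y) \<in> map_prod f f ` E" "f x \<in> f ` K"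
    by (auto intro: rev_image_eqI)
  then show "f y \<in> (map_prod f f ` E) `` (f ` K)" by (rule ImageI)
qed

lemma hyper_entourage_image:
  assumes "f \<in> M \<rightarrow> N"
  shows "map_prod (image f) (image f) ` hyper_entourage M E
           \<subseteq> hyper_entourage N (map_prod f f ` E)"
proof (clarsimp simp: hyper_entourage_def, intro conjI)
  fix K L assume sub: "K \<subseteq> M" "L \<subseteq> M" and KL: "K \<subseteq> E `` L" "L \<subseteq> E `` K"
  show "f ` K \<subseteq> N" "f ` L \<subseteq> N" using assms sub by auto
  show "f ` K \<subseteq> (map_prod f f ` E) `` (f ` L)"
    using image_mono[OF KL(1)] image_Image_subset by (rule subset_trans)
  show "f ` L \<subseteq> (map_prod f f ` E) `` (f ` K)"
    using image_mono[OF KL(2)] image_Image_subset by (rule subset_trans)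
qed

lemma bornologous_image:
  assumes "bornologous M \<E> N \<F> f"
  shows "bornologous (Pow M) (hyper_structure M \<E>) (Pow N) (hyper_structure N \<F>) (image f)"
  unfolding bornologous_def
proof (intro conjI ballI)
  have f: "f \<in> M \<rightarrow> N" and push: "\<And>E. E \<in> \<E> \<Longrightarrow> map_prod f f ` E \<in> \<F>"
    using assms by (auto simp: bornologous_def)
  show "image f \<in> Pow M \<rightarrow> Pow N" using f by auto
  fix A assume "A \<in> hyper_structure M \<E>"
  then obtain E where E: "E \<in> \<E>" and A: "A \<subseteq> hyper_entourage M E"
    by (auto simp: hyper_structure_def)
  have "map_prod (image f) (image f) ` A \<subseteq> hyper_entourage N (map_prod f f ` E)"
    using image_mono[OF A] hyper_entourage_image[OF f] by (rule subset_trans)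
  then show "map_prod (image f) (image f) ` A \<in> hyper_structure N \<F>"
    using push[OF E] by (auto simp: hyper_structure_def)
qed

text \<open>
  Maps are total functions, so the inverse of \<open>image f\<close> and the direct image map of the inverse
  of \<open>f\<close> can be identified only on the carrier; being bornologous is transferred across such
  an identification.
\<close>

lemma bornologous_cong:
  assumes "bornologous M \<E> N \<F> f"
    and "\<And>E. E \<in> \<E> \<Longrightarrow> E \<subseteq> M \<times> M"
    and eq: "\<And>x. x \<in> M \<Longrightarrow> f x = g x"
  shows "bornologous M \<E> N \<F> g"
proof -
  have "map_prod g g ` E = map_prod f f ` E" if "E \<in> \<E>" for E
    using assms(2)[OF that] by (intro image_cong) (auto simp: eq)
  moreover have "g \<in> M \<rightarrow> N"
    using assms(1) by (auto simp: bornologous_def simp flip: eq)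
  ultimately show ?thesis
    using assms(1) by (simp add: bornologous_def)
qed

lemma inv_into_Pow_image:
  assumes "bij_betw f M N" and "B \<subseteq> N"
  shows "inv_into (Pow M) (image f) B = inv_into M f ` B"
proof (rule inv_into_f_eq)
  show "inj_on (image f) (Pow M)"
    using assms(1) by (simp add: bij_betw_def inj_on_image_Pow)
  show "inv_into M f ` B \<in> Pow M"
    using assms bij_betwE[OF bij_betw_inv_into[OF assms(1)]] by auto
  show "f ` inv_into M f ` B = B"
    using assms by (simp add: image_inv_into_cancel bij_betw_def)
qed

lemma asymorphism_image:
  assumes "asymorphism M \<E> N \<F> f"
  shows "asymorphism (Pow M) (hyper_structure M \<E>) (Pow N) (hyper_structure N \<F>) (image f)"
  unfolding asymorphism_def
proof (intro conjI)
  have bij: "bij_betw f M N" and b: "bornologous M \<E> N \<F> f"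
    and b': "bornologous N \<F> M \<E> (inv_into M f)"
    using assms by (auto simp: asymorphism_def)
  show "bij_betw (image f) (Pow M) (Pow N)" using bij by (rule bij_betw_Pow)
  show "bornologous (Pow M) (hyper_structure M \<E>) (Pow N) (hyper_structure N \<F>) (image f)"
    using b by (rule bornologous_image)
  show "bornologous (Pow N) (hyper_structure N \<F>) (Pow M) (hyper_structure M \<E>)
          (inv_into (Pow M) (image f))"
  proof (rule bornologous_cong[OF bornologous_image[OF b']])
    show "A \<subseteq> Pow N \<times> Pow N" if "A \<in> hyper_structure N \<F>" for A
      using that by (rule hyper_structure_subset)
    show "inv_into M f ` B = inv_into (Pow M) (image f) B" if "B \<in> Pow N" for B
      using inv_into_Pow_image[OF bij] that by simp
  qed
qed

lemma coarse_dynamical_system_hyper: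
  fixes G (structure)
  assumes "coarse_dynamical_system M \<E> \<phi> G \<G>"
  shows "coarse_dynamical_system (Pow M) (hyper_structure M \<E>) (hyper_action \<phi>) G \<G>"
proof -
  interpret coarse_dynamical_system M \<E> \<phi> G \<G> by (fact assms)
  interpret hyper: coarse_space "Pow M" "hyper_structure M \<E>"
    by (rule coarse_space_hyper) (rule phase.coarse_space_axioms)
  show ?thesis
  proof
    show "Pow M \<noteq> {}" by auto
    show "asymorphism (Pow M) (hyper_structure M \<E>) (Pow M) (hyper_structure M \<E>)
            (hyper_action \<phi> g)" if "g \<in> carrier G" for g
      using asymorphism_image[OF asymorphism[OF that]] by (simp add: hyper_action_def)
    show "hyper_action \<phi> g1 (hyper_action \<phi> g2 K) = hyper_action \<phi> (g1 \<otimes> g2) K"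
      if "g1 \<in> carrier G" "g2 \<in> carrier G" "K \<in> Pow M" for g1 g2 K
      unfolding hyper_action_def image_image
      using that by (intro image_cong) (auto intro: action_mult)
    show "hyper_action \<phi> \<one> K = K" if "K \<in> Pow M" for K
    proof -
      have "\<phi> \<one> ` K = id ` K" using that by (intro image_cong) (auto intro: action_one)
      then show ?thesis by (simp add: hyper_action_def)
    qed
  qed
qed

theorem theorem3p17:
  fixes M :: "'m set" and \<E> :: "('m \<times> 'm) set set" and \<phi> :: "'g \<Rightarrow> 'm \<Rightarrow> 'm"
    and G :: "('g, 'a) monoid_scheme" and \<G> :: "('g \<times> 'g) set set"
    and M' :: "'n set" and \<E>' :: "('n \<times> 'n) set set" and \<phi>' :: "'k \<Rightarrow> 'n \<Rightarrow> 'n"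
    and G' :: "('k, 'b) monoid_scheme" and \<G>' :: "('k \<times> 'k) set set"
    and f :: "'m \<Rightarrow> 'n" and h :: "'g \<Rightarrow> 'k"
  assumes "coarse_conjugate M \<E> \<phi> G \<G> M' \<E>' \<phi>' G' \<G>' f h"
  shows "coarse_conjugate
           (Pow M) (hyper_structure M \<E>) (hyper_action \<phi>) G \<G>
           (Pow M') (hyper_structure M' \<E>') (hyper_action \<phi>') G' \<G>'
           (image f) h"
proof -
  have sys: "coarse_dynamical_system M \<E> \<phi> G \<G>" "coarse_dynamical_system M' \<E>' \<phi>' G' \<G>'"
    and f: "asymorphism M \<E> M' \<E>' f"
    and h: "asymorphism (carrier G) \<G> (carrier G') \<G>' h" "h \<in> hom G G'"
    and intertwine: "\<And>g m. g \<in> carrier G \<Longrightarrow> m \<in> M \<Longrightarrow> f (\<phi> g m) = \<phi>' (h g) (f m)"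
    using assms by (auto simp: coarse_conjugate_def)
  have "f ` hyper_action \<phi> g K = hyper_action \<phi>' (h g) (f ` K)"
    if "g \<in> carrier G" "K \<in> Pow M" for g K
    unfolding hyper_action_def image_image
    using that by (intro image_cong) (auto intro: intertwine)
  then show ?thesis
    unfolding coarse_conjugate_def
    using sys[THEN coarse_dynamical_system_hyper] asymorphism_image[OF f] h by blast
qed

end
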